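(* Let $n\geqslant 1$ and let $p_1,\dots,p_n\in[0,1]$ not satisfy $p_1=\cdots=p_n\in\{0,1\}$. Let $K_n$ be a random variable with the binomial distribution $\mathscr{B}(n,p)$. Then for every $x\in\mathbb{R}$, \[ \bigl|\mathbb{P}(S_n\leqslant x)-\mathbb{P}(K_n\leqslant x)\bigr|\leqslant \sqrt{\chi^2(\mathscr{L}(S_n),\mathscr{B}(n,p))}\,\sqrt{R(x)}, \] where $R(x)=\min\bigl\{\mathbb{P}(K_n\leqslant x),\,\mathbb{P}(K_n>x)\bigr\}$.
   Context: Let $S_n=I_1+\cdots+I_n$ be a sum of independent indicator random variables with $\mathbb{P}(I_j=1)=p_j$ and $\mathbb{P}(I_j=0)=1-p_j$, where $p_j\in[0,1]$; $\mathscr{L}(S_n)$ is its law. Put $p=\frac1n\sum_{j=1}^n p_j$ and $q=1-p$. It is assumed throughout that it is not the case that $p_1=\cdots=p_n\in\{0,1\}$, so that $0<p<1$ and $0<q<1$. $\mathscr{B}(n,p)$ is the binomial distribution with weights $b(n,p,j)=\binom nj p^jq^{n-j}$, $0\leqslant j\leqslant n$. The $\chi^2$-distance is \[ \chi^2(\mathscr{L}(S_n),\mathscr{B}(n,p))=\sum_{j=0}^n\left|\frac{\mathbb{P}(S_n=j)}{b(n,p,j)}-1\right|^2 b(n,p,j). \] *)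

theory Defs
  imports "HOL-Probability.Probability"
begin

definition chi2_binomial :: "nat measure \<Rightarrow> nat \<Rightarrow> real \<Rightarrow> real" where
  "chi2_binomial \<mu> n p =
     (\<Sum>j=0..n. \<bar>measure \<mu> {j} / pmf (binomial_pmf n p) j - 1\<bar>\<^sup>2 * pmf (binomial_pmf n p) j)"

end

theory Submission
  imports Defs
begin

text \<open>The inequality is an instance of Cauchy--Schwarz applied to the point masses of the two
  laws. Both live on \<open>{0..n}\<close>, and because \<open>0 < pbar < 1\<close> the binomial law charges each
  point there, so the likelihood ratio \<open>f j / b j\<close> is defined wherever the law \<open>f\<close> of \<open>S\<close> has
  mass. For a set \<open>B\<close> of points, the difference of the masses of \<open>B\<close> is the integral over \<open>B\<close> of
  \<open>f / b - 1\<close> against \<open>b\<close>, which Cauchy--Schwarz in \<open>L\<^sup>2(b)\<close> bounds by the square root of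
  \<open>\<chi>\<^sup>2\<close> times the square root of the binomial mass of \<open>B\<close>
  (\<open>abs_sum_diff_le_sqrt_chi2\<close>). Since both laws have total mass one, passing from \<open>B\<close> to its
  complement only changes the sign of the difference; hence the smaller of the two binomial masses
  may be used (\<open>abs_sum_diff_le_sqrt_chi2_min\<close>). The theorem is the case where \<open>B\<close> consists of the
  points that are at most \<open>x\<close>.\<close>

lemma abs_sum_diff_le_sqrt_chi2:
  fixes f b :: "'a \<Rightarrow> real"
  assumes "finite A" "B \<subseteq> A" and pos: "\<And>j. j \<in> A \<Longrightarrow> b j > 0"
  shows "\<bar>(\<Sum>j\<in>B. f j) - (\<Sum>j\<in>B. b j)\<bar>
    \<le> sqrt (\<Sum>j\<in>A. \<bar>f j / b j - 1\<bar>\<^sup>2 * b j) * sqrt (\<Sum>j\<in>B. b j)"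
proof -
  have pos': "b j > 0" if "j \<in> B" for j
    using pos that assms(2) by blast
  \<comment> \<open>One factor \<open>sqrt (b j)\<close> goes to the ratio and the other to the constant function \<open>1\<close>.\<close>
  have "(\<Sum>j\<in>B. f j) - (\<Sum>j\<in>B. b j) = (\<Sum>j\<in>B. (f j / b j - 1) * sqrt (b j) * sqrt (b j))"
    unfolding sum_subtractf[symmetric]
  proof (rule sum.cong[OF refl])
    fix j assume "j \<in> B"
    then have "b j > 0" by (rule pos')
    then show "f j - b j = (f j / b j - 1) * sqrt (b j) * sqrt (b j)"
      by (simp add: mult.assoc field_simps)
  qed
  also have "\<bar>\<dots>\<bar> \<le> (\<Sum>j\<in>B. \<bar>(f j / b j - 1) * sqrt (b j)\<bar> * \<bar>sqrt (b j)\<bar>)"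
    by (rule order_trans[OF sum_abs]) (simp add: abs_mult)
  also have "\<dots> \<le> L2_set (\<lambda>j. (f j / b j - 1) * sqrt (b j)) B * L2_set (\<lambda>j. sqrt (b j)) B"
    by (rule L2_set_mult_ineq)
  also have "\<dots> = sqrt (\<Sum>j\<in>B. \<bar>f j / b j - 1\<bar>\<^sup>2 * b j) * sqrt (\<Sum>j\<in>B. b j)"
    using pos' by (simp add: L2_set_def power_mult_distrib less_imp_le cong: sum.cong)
  also have "\<dots> \<le> sqrt (\<Sum>j\<in>A. \<bar>f j / b j - 1\<bar>\<^sup>2 * b j) * sqrt (\<Sum>j\<in>B. b j)"
    using assms(1,2) pos pos'
    by (intro mult_right_mono real_sqrt_le_mono sum_mono2 real_sqrt_ge_zero sum_nonneg)
      (auto intro: less_imp_le intro!: mult_nonneg_nonneg)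
  finally show ?thesis .
qed

lemma abs_sum_diff_le_sqrt_chi2_min:
  fixes f b :: "'a \<Rightarrow> real"
  assumes "finite A" "B \<subseteq> A" "\<And>j. j \<in> A \<Longrightarrow> b j > 0"
    and total: "(\<Sum>j\<in>A. f j) = (\<Sum>j\<in>A. b j)"
  shows "\<bar>(\<Sum>j\<in>B. f j) - (\<Sum>j\<in>B. b j)\<bar>
    \<le> sqrt (\<Sum>j\<in>A. \<bar>f j / b j - 1\<bar>\<^sup>2 * b j) * sqrt (min (\<Sum>j\<in>B. b j) (\<Sum>j\<in>A - B. b j))"
proof -
  have "(\<Sum>j\<in>A - B. f j) - (\<Sum>j\<in>A - B. b j) = - ((\<Sum>j\<in>B. f j) - (\<Sum>j\<in>B. b j))"
    using total sum.subset_diff[OF assms(2,1), of f] sum.subset_diff[OF assms(2,1), of b]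
    by simp
  then have "\<bar>(\<Sum>j\<in>B. f j) - (\<Sum>j\<in>B. b j)\<bar>
    \<le> sqrt (\<Sum>j\<in>A. \<bar>f j / b j - 1\<bar>\<^sup>2 * b j) * sqrt (\<Sum>j\<in>A - B. b j)"
    using abs_sum_diff_le_sqrt_chi2[where f = f and b = b, OF assms(1) Diff_subset[of A B] assms(3)]
    by simp
  with abs_sum_diff_le_sqrt_chi2[where f = f and b = b, OF assms(1,2,3)] show ?thesis
    by (simp add: min_def)
qed

lemma measure_eq_sum_of_support:
  assumes "prob_space D" and sets: "sets D = UNIV"
    and "finite A" and full: "measure D A = 1"
  shows "measure D X = (\<Sum>j\<in>X \<inter> A. measure D {j})"
proof -
  interpret prob_space D by fact
  have "AE y in D. y \<in> A"
    using full by (subst prob_eq_1[symmetric]) (auto simp: sets)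
  then have "measure D X = measure D (X \<inter> A)"
    by (intro finite_measure_eq_AE) (auto simp: sets)
  also have "\<dots> = (\<Sum>j\<in>X \<inter> A. measure D {j})"
    using assms(3) by (intro finite_measure_eq_sum_singleton) (auto simp: sets)
  finally show ?thesis .
qed

lemma average_in_open_unit_interval:
  fixes p :: "nat \<Rightarrow> real"
  assumes n: "n \<ge> 1" and p: "\<And>j. j \<in> {1..n} \<Longrightarrow> p j \<in> {0..1}"
    and ne: "\<not> (\<exists>c\<in>{0, 1}. \<forall>j\<in>{1..n}. p j = c)"
  shows "(\<Sum>j=1..n. p j) / real n \<in> {0<..<1}"
proof -
  have "(\<Sum>j=1..n. p j) \<noteq> 0"
    using sum_nonneg_eq_0_iff[of "{1..n}" p] p ne by auto
  moreover have "(\<Sum>j=1..n. p j) \<ge> 0"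
    using p by (intro sum_nonneg) auto
  moreover have "(\<Sum>j=1..n. 1 - p j) \<noteq> 0"
    using sum_nonneg_eq_0_iff[of "{1..n}" "\<lambda>j. 1 - p j"] p ne by auto
  moreover have "(\<Sum>j=1..n. 1 - p j) \<ge> 0"
    using p by (intro sum_nonneg) auto
  ultimately show ?thesis
    using n by (simp add: sum_subtractf)
qed

theorem mainTheorem3:
  fixes n :: nat
    and p :: "nat \<Rightarrow> real" and pbar :: real
    and M :: "'a measure" and I :: "nat \<Rightarrow> 'a \<Rightarrow> nat" and S :: "'a \<Rightarrow> nat"
    and N :: "'b measure" and K :: "'b \<Rightarrow> nat"
    and x :: real
  assumes "n \<ge> 1"
    and "\<And>j. j \<in> {1..n} \<Longrightarrow> p j \<in> {0..1}"
    and "\<not> (\<exists>c\<in>{0, 1}. \<forall>j\<in>{1..n}. p j = c)"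
    and "pbar = (\<Sum>j=1..n. p j) / real n"
    and "prob_space M"
    and "prob_space.indep_vars M (\<lambda>_. count_space UNIV) I {1..n}"
    and "\<And>j. j \<in> {1..n} \<Longrightarrow> \<P>(\<omega> in M. I j \<omega> = 1) = p j"
    and "\<And>j. j \<in> {1..n} \<Longrightarrow> \<P>(\<omega> in M. I j \<omega> = 0) = 1 - p j"
    and "S = (\<lambda>\<omega>. \<Sum>j=1..n. I j \<omega>)"
    and "prob_space N"
    and "K \<in> measurable N (count_space UNIV)"
    and "distr N (count_space UNIV) K = measure_pmf (binomial_pmf n pbar)"
  shows "\<bar>\<P>(\<omega> in M. real (S \<omega>) \<le> x) - \<P>(\<omega> in N. real (K \<omega>) \<le> x)\<bar>
      \<le> sqrt (chi2_binomial (distr M (count_space UNIV) S) n pbar)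
        * sqrt (min \<P>(\<omega> in N. real (K \<omega>) \<le> x) \<P>(\<omega> in N. real (K \<omega>) > x))"
proof -
  interpret M: prob_space M by fact
  interpret N: prob_space N by fact
  define D where "D = distr M (count_space UNIV) S"
  define b where "b = (\<lambda>j. pmf (binomial_pmf n pbar) j)"
  define L where "L = {k. real k \<le> x}"
  have I: "I j \<in> measurable M (count_space UNIV)" if "j \<in> {1..n}" for j
    using assms(6) that by (auto simp: M.indep_vars_def)
  have S [measurable]: "S \<in> measurable M (count_space UNIV)"
    unfolding assms(9) using I by (intro measurable_sum_nat) auto
  have pbar: "0 < pbar" "pbar < 1"
    using average_in_open_unit_interval[of n p] assms(1-4) by auto

  interpret D: prob_space D
    unfolding D_def by (rule M.prob_space_distr) (rule S)
  have "AE \<omega> in M. I j \<omega> \<le> 1" if j: "j \<in> {1..n}" for j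
  proof -
    note [measurable] = I[OF j]
    have "M.prob {\<omega>\<in>space M. I j \<omega> \<le> 1}
        = M.prob ({\<omega>\<in>space M. I j \<omega> = 0} \<union> {\<omega>\<in>space M. I j \<omega> = 1})"
      by (rule arg_cong[where f = M.prob]) auto
    also have "\<dots> = M.prob {\<omega>\<in>space M. I j \<omega> = 0} + M.prob {\<omega>\<in>space M. I j \<omega> = 1}"
      by (rule M.finite_measure_Union) auto
    also have "\<dots> = 1"
      using assms(7,8)[OF j] by simp
    finally have "AE \<omega> in M. \<omega> \<in> {\<omega>\<in>space M. I j \<omega> \<le> 1}"
      by (subst M.prob_eq_1[symmetric]) auto
    then show ?thesis by eventually_elim simp
  qed
  then have "AE \<omega> in M. \<forall>j\<in>{1..n}. I j \<omega> \<le> 1"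
    by (intro AE_finite_allI) auto
  then have "AE \<omega> in M. S \<omega> \<le> n"
  proof eventually_elim
    case (elim \<omega>)
    then show ?case
      using sum_bounded_above[of "{1..n}" "\<lambda>j. I j \<omega>" 1] by (simp add: assms(9))
  qed
  then have "AE y in D. y \<in> {0..n}"
    unfolding D_def by (subst AE_distr_iff) auto
  then have D_full: "measure D {0..n} = 1"
    by (subst D.prob_eq_1) (auto simp: D_def)
  have D_sum: "measure D X = (\<Sum>j\<in>X \<inter> {0..n}. measure D {j})" for X
    by (rule measure_eq_sum_of_support) (simp_all add: D.prob_space_axioms D_full, simp add: D_def)

  have b_pos: "b j > 0" if "j \<in> {0..n}" for j
    using pbar that by (simp add: b_def)
  have "set_pmf (binomial_pmf n pbar) = {0..n}"
    using pbar by (auto simp: set_pmf_binomial_eq)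
  then have B_full: "measure (binomial_pmf n pbar) {0..n} = 1"
    by (simp add: measure_pmf.prob_eq_1 AE_measure_pmf_iff)
  have B_sum: "measure (binomial_pmf n pbar) X = (\<Sum>j\<in>X \<inter> {0..n}. b j)" for X
    using measure_eq_sum_of_support[OF measure_pmf.prob_space_axioms _ _ B_full]
    by (simp add: b_def measure_pmf_single)

  have S_law: "\<P>(\<omega> in M. real (S \<omega>) \<le> x) = (\<Sum>j\<in>L \<inter> {0..n}. measure D {j})"
  proof -
    have "\<P>(\<omega> in M. real (S \<omega>) \<le> x) = measure D L"
      using S unfolding D_def
      by (subst measure_distr) (auto simp: L_def intro!: arg_cong[where f = M.prob])
    then show ?thesis using D_sum[of L] by (rule trans)
  qed
  have K_law: "N.prob {\<omega>\<in>space N. K \<omega> \<in> X} = (\<Sum>j\<in>X \<inter> {0..n}. b j)" for X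
    unfolding B_sum[symmetric] assms(12)[symmetric]
    using assms(11) by (subst measure_distr) (auto intro!: arg_cong[where f = N.prob])
  have K_le: "\<P>(\<omega> in N. real (K \<omega>) \<le> x) = (\<Sum>j\<in>L \<inter> {0..n}. b j)"
    using K_law[of L] by (simp add: L_def)
  have "- L \<inter> {0..n} = {0..n} - L \<inter> {0..n}"
    by auto
  then have K_gt: "\<P>(\<omega> in N. real (K \<omega>) > x) = (\<Sum>j\<in>{0..n} - L \<inter> {0..n}. b j)"
    using K_law[of "- L"] by (simp add: L_def not_le)
  have chi2: "chi2_binomial D n pbar
      = (\<Sum>j\<in>{0..n}. \<bar>measure D {j} / b j - 1\<bar>\<^sup>2 * b j)"
    by (simp add: chi2_binomial_def b_def)
  have "(\<Sum>j\<in>{0..n}. measure D {j}) = (\<Sum>j\<in>{0..n}. b j)"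
    using D_sum[of "{0..n}"] B_sum[of "{0..n}"] D_full B_full by simp
  then show ?thesis
    unfolding S_law K_le K_gt chi2 D_def[symmetric]
    by (intro abs_sum_diff_le_sqrt_chi2_min b_pos) auto
qed

end
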